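(* Let $m\ge 1$ and let $\underline{r}=(r_1,\dots,r_m)$ be pairwise coprime integers $r_i\ge 2$. For $n\ge0$ let $CP_{\underline{r},n}$ be the set of partitions of $n$ none of whose parts is divisible by any $r_l$, let $m_i(\rho)$ denote the multiplicity of $i$ in a partition $\rho$, let $W_{\underline{r},s,n}=\sum_{\rho\in CP_{\underline{r},n}}|\{i\ge1\mid m_i(\rho)\ge s\}|$, and for $1\le i\le m$ let $$c_{r_i,n}=\sum_{\substack{j\ge 1\\ r_l\nmid j \text{ for all } l}}\ \sum_{k_1,\dots,k_m\ge0} k_i\, W_{\underline{r},\,r_1^{k_1}\cdots r_m^{k_m}j,\,n}.$$ Let $\Phi_{\underline{r}}(q)=\prod_{n\ge1,\ r_l\nmid n\ \forall l}(1-q^n)^{-1}=\sum_{n\ge0}|CP_{\underline{r},n}|q^n$. Then for each $1\le i\le m$, $$\sum_{n\ge0}c_{r_i,n}q^n=\Phi_{\underline{r}}(q)\left(\sum_{n\ge1}\frac{q^{r_in}}{1-q^{r_in}}+\sum_{k=1}^{m-1}(-1)^k\sum_{\substack{1\le l_1<\dots<l_k\le m\\ l_1,\dots,l_k\ne i}}\ \sum_{n\ge1}\frac{q^{r_ir_{l_1}\cdots r_{l_k}n}}{1-q^{r_ir_{l_1}\cdots r_{l_k}n}}\right)=\Phi_{\underline{r}}(q)\sum_{\substack{n\ge1\\ r_l\nmid n\ \forall l\ne i}}\frac{q^{r_in}}{1-q^{r_in}}.$$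
   Context: Identities are of formal power series in $q$. *)

theory Defs
  imports "HOL-Analysis.Analysis" "HOL-Computational_Algebra.Formal_Power_Series"
    "HOL-Library.Multiset" "HOL-Library.FuncSet"
begin

text \<open>
  The tuple of moduli is a function \<open>r :: nat \<Rightarrow> nat\<close> of which only the values on
  \<open>{1..m}\<close> are used. A partition is the multiset of its (positive) parts.
\<close>

definition indivisible :: "nat \<Rightarrow> (nat \<Rightarrow> nat) \<Rightarrow> nat \<Rightarrow> bool" where
  "indivisible m r a \<longleftrightarrow> (\<forall>l\<in>{1..m}. \<not> r l dvd a)"

definition CP :: "nat \<Rightarrow> (nat \<Rightarrow> nat) \<Rightarrow> nat \<Rightarrow> nat multiset set" where
  "CP m r n = {\<rho>. 0 \<notin># \<rho> \<and> sum_mset \<rho> = n \<and> (\<forall>a\<in>#\<rho>. indivisible m r a)}"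

text \<open>
  The inner set is infinite, hence of \<open>card\<close> 0, when \<open>s = 0\<close>; only \<open>s \<ge> 1\<close> is ever used.
\<close>

definition W :: "nat \<Rightarrow> (nat \<Rightarrow> nat) \<Rightarrow> nat \<Rightarrow> nat \<Rightarrow> nat" where
  "W m r s n = (\<Sum>\<rho>\<in>CP m r n. card {i. i \<ge> 1 \<and> count \<rho> i \<ge> s})"

text \<open>
  The two infinite sums have only finitely many nonzero terms, because \<open>W m r s n = 0\<close> for
  \<open>s > n\<close> (lemmas \<open>cnum_inner_finite\<close> and \<open>cnum_outer_finite\<close> below).
\<close>

definition cnum :: "nat \<Rightarrow> (nat \<Rightarrow> nat) \<Rightarrow> nat \<Rightarrow> nat \<Rightarrow> nat" where
  "cnum m r i n =
     (\<Sum>\<^sub>\<infinity>j\<in>{j. j \<ge> 1 \<and> indivisible m r j}.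
       \<Sum>\<^sub>\<infinity>k\<in>{1..m} \<rightarrow>\<^sub>E (UNIV :: nat set).
         k i * W m r ((\<Prod>l=1..m. r l ^ k l) * j) n)"

text \<open>
  Infinite sums and products of formal power series are taken in the \<open>X\<close>-adic topology, which is
  the library's metric on \<open>fps\<close>. Coefficients are rational so that series can be divided.
\<close>

definition Phi :: "nat \<Rightarrow> (nat \<Rightarrow> nat) \<Rightarrow> rat fps" where
  "Phi m r = (\<Prod>n. if n \<ge> 1 \<and> indivisible m r n then inverse (1 - fps_X ^ n) else 1)"

definition lambert :: "nat \<Rightarrow> nat set \<Rightarrow> rat fps" where
  "lambert a A = (\<Sum>\<^sub>\<infinity>n\<in>A. fps_X ^ (a * n) / (1 - fps_X ^ (a * n)))"

subsection \<open>The infinite sums and the infinite product converge\<close>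

lemma size_le_sum_mset:
  fixes \<rho> :: "nat multiset"
  shows "0 \<notin># \<rho> \<Longrightarrow> size \<rho> \<le> sum_mset \<rho>"
  by (induction \<rho>) auto

lemma finite_CP: "finite (CP m r n)"
proof (rule finite_subset)
  show "CP m r n \<subseteq> mset ` {xs. set xs \<subseteq> {..n} \<and> length xs \<le> n}"
  proof
    fix \<rho> assume "\<rho> \<in> CP m r n"
    hence 1: "0 \<notin># \<rho>" "sum_mset \<rho> = n" by (auto simp: CP_def)
    have 2: "a \<le> n" if "a \<in># \<rho>" for a
      using that 1(2) by (metis le_add1 multi_member_split sum_mset.add_mset)
    obtain xs where xs: "\<rho> = mset xs" by (metis ex_mset)
    thus "\<rho> \<in> mset ` {xs. set xs \<subseteq> {..n} \<and> length xs \<le> n}"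
      using size_le_sum_mset[OF 1(1)] 1(2) 2 by auto
  qed
  show "finite (mset ` {xs. set xs \<subseteq> {..n} \<and> length xs \<le> n})"
    by (intro finite_imageI finite_lists_length_le) auto
qed

lemma W_eq_0:
  assumes "s > n"
  shows "W m r s n = 0"
proof -
  have "{i. i \<ge> 1 \<and> count \<rho> i \<ge> s} = {}" if "\<rho> \<in> CP m r n" for \<rho>
  proof -
    have "count \<rho> i \<le> n" for i
      using count_le_size[of \<rho> i] size_le_sum_mset[of \<rho>] that by (auto simp: CP_def)
    hence "\<not> s \<le> count \<rho> i" for i using assms by (meson le_trans not_le)
    thus ?thesis by simp
  qed
  thus ?thesis unfolding W_def by (metis (no_types, lifting) card.empty sum.neutral)
qed

lemma power_prod_ge:
  fixes m l :: nat
  assumes "\<And>l. l \<in> {1..m} \<Longrightarrow> r l \<ge> (2::nat)" "l \<in> {1..m}"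
  shows "k l < (\<Prod>l=1..m. r l ^ k l)"
proof -
  have "k l < 2 ^ k l" by simp
  also have "\<dots> \<le> r l ^ k l" using assms by (intro power_mono) auto
  also have "\<dots> \<le> (\<Prod>l=1..m. r l ^ k l)"
  proof (rule dvd_imp_le)
    show "r l ^ k l dvd (\<Prod>l=1..m. r l ^ k l)"
      using assms(2) by (intro dvd_prodI) auto
    show "(\<Prod>l=1..m. r l ^ k l) > 0"
      using assms(1) by (intro prod_pos) (force intro: zero_less_power)
  qed
  finally show ?thesis .
qed

lemma cnum_inner_finite:
  assumes "\<And>l. l \<in> {1..m} \<Longrightarrow> r l \<ge> 2" "j \<ge> 1"
  shows "finite {k \<in> {1..m} \<rightarrow>\<^sub>E UNIV. k i * W m r ((\<Prod>l=1..m. r l ^ k l) * j) n \<noteq> 0}"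
proof (rule finite_subset)
  show "{k \<in> {1..m} \<rightarrow>\<^sub>E UNIV. k i * W m r ((\<Prod>l=1..m. r l ^ k l) * j) n \<noteq> 0}
          \<subseteq> {1..m} \<rightarrow>\<^sub>E {..n}"
  proof
    fix k assume k: "k \<in> {k \<in> {1..m} \<rightarrow>\<^sub>E UNIV. k i * W m r ((\<Prod>l=1..m. r l ^ k l) * j) n \<noteq> 0}"
    hence "(\<Prod>l=1..m. r l ^ k l) * j \<le> n"
      using W_eq_0[of n "(\<Prod>l=1..m. r l ^ k l) * j" m r] by (metis (mono_tags, lifting) leI mem_Collect_eq mult_0_right)
    moreover have "(\<Prod>l=1..m. r l ^ k l) \<le> (\<Prod>l=1..m. r l ^ k l) * j"
      using assms(2) by simp
    moreover have "k l < (\<Prod>l=1..m. r l ^ k l)" if "l \<in> {1..m}" for l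
      by (rule power_prod_ge) (use assms(1) that in auto)
    ultimately have "k l \<le> n" if "l \<in> {1..m}" for l
      using that by (meson less_imp_le_nat order_trans)
    thus "k \<in> {1..m} \<rightarrow>\<^sub>E {..n}" using k by (auto simp: PiE_iff)
  qed
  show "finite ({1..m} \<rightarrow>\<^sub>E {..n})" by (intro finite_PiE) auto
qed

lemma cnum_outer_finite:
  assumes "\<And>l. l \<in> {1..m} \<Longrightarrow> r l \<ge> 2"
  shows "finite {j. \<exists>k. W m r ((\<Prod>l=1..m. r l ^ k l) * j) n \<noteq> 0}"
proof (rule finite_subset)
  show "{j. \<exists>k. W m r ((\<Prod>l=1..m. r l ^ k l) * j) n \<noteq> 0} \<subseteq> {..n}"
  proof
    fix j assume "j \<in> {j. \<exists>k. W m r ((\<Prod>l=1..m. r l ^ k l) * j) n \<noteq> 0}"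
    then obtain k where "W m r ((\<Prod>l=1..m. r l ^ k l) * j) n \<noteq> 0" by blast
    hence "(\<Prod>l=1..m. r l ^ k l) * j \<le> n" by (metis W_eq_0 not_le)
    moreover have "(\<Prod>l=1..m. r l ^ k l) \<ge> 1"
      using assms by (intro prod_ge_1 one_le_power) fastforce
    hence "j \<le> (\<Prod>l=1..m. r l ^ k l) * j" by simp
    ultimately show "j \<in> {..n}" unfolding atMost_iff by (rule order_trans[rotated])
  qed
qed simp

lemma fps_summable_onI:
  fixes f :: "'b \<Rightarrow> 'a :: comm_ring_1 fps"
  assumes "\<And>N. finite {n \<in> A. fps_nth (f n) N \<noteq> 0}"
  shows "f summable_on A"
proof -
  define S where "S N = {n \<in> A. fps_nth (f n) N \<noteq> 0}" for N
  have "(f has_sum Abs_fps (\<lambda>N. \<Sum>n\<in>S N. fps_nth (f n) N)) A"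
    unfolding has_sum_def
  proof (rule tendsto_fpsI)
    fix N
    have fin: "finite (S N)" "S N \<subseteq> A" using assms by (auto simp: S_def)
    show "\<forall>\<^sub>F F in finite_subsets_at_top A.
        fps_nth (sum f F) N = fps_nth (Abs_fps (\<lambda>N. \<Sum>n\<in>S N. fps_nth (f n) N)) N"
      unfolding eventually_finite_subsets_at_top
    proof (intro exI[of _ "S N"] conjI allI impI)
      fix F assume F: "finite F \<and> S N \<subseteq> F \<and> F \<subseteq> A"
      have "(\<Sum>n\<in>F. fps_nth (f n) N) = (\<Sum>n\<in>S N. fps_nth (f n) N)"
        using F by (intro sum.mono_neutral_right) (auto simp: S_def)
      thus "fps_nth (sum f F) N = fps_nth (Abs_fps (\<lambda>N. \<Sum>n\<in>S N. fps_nth (f n) N)) N"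
        by (simp add: fps_sum_nth)
    qed (use fin in auto)
  qed
  thus ?thesis by (auto simp: summable_on_def)
qed

lemma lambert_summable:
  assumes "a \<ge> 1" "0 \<notin> A"
  shows "(\<lambda>n. fps_X ^ (a * n) / (1 - fps_X ^ (a * n)) :: rat fps) summable_on A"
proof (rule fps_summable_onI)
  fix N
  have "fps_nth (fps_X ^ (a * n) / (1 - fps_X ^ (a * n)) :: rat fps) N = 0" if "n > N" for n
  proof -
    have an: "a * n > N" using that assms(1) by (metis less_le_trans mult_le_mono1 nat_mult_1)
    have "fps_nth (1 - fps_X ^ (a * n) :: rat fps) 0 \<noteq> 0"
      using an assms(1) that by (simp add: Suc_le_eq)
    hence "fps_X ^ (a * n) / (1 - fps_X ^ (a * n)) =
        fps_X ^ (a * n) * inverse (1 - fps_X ^ (a * n) :: rat fps)"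
      by (rule fps_divide_unit)
    thus ?thesis using an by (simp add: fps_X_power_mult_nth)
  qed
  hence "{n \<in> A. fps_nth (fps_X ^ (a * n) / (1 - fps_X ^ (a * n)) :: rat fps) N \<noteq> 0} \<subseteq> {..N}"
    by (blast intro: leI)
  thus "finite {n \<in> A. fps_nth (fps_X ^ (a * n) / (1 - fps_X ^ (a * n)) :: rat fps) N \<noteq> 0}"
    using finite_subset by blast
qed

lemma Phi_convergent:
  "convergent_prod (\<lambda>n. if n \<ge> 1 \<and> indivisible m r n then inverse (1 - fps_X ^ n :: rat fps) else 1)"
    (is "convergent_prod ?f")
proof -
  define P where "P n = (\<Prod>i\<le>n. ?f i)" for n
  have nth: "fps_nth (?f n) k = (if k = 0 then 1 else 0)" if "k < n" for n k
  proof (cases "n \<ge> 1 \<and> indivisible m r n")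
    case True
    let ?g = "1 - fps_X ^ n :: rat fps"
    have g0: "fps_nth ?g 0 \<noteq> 0" using that by simp
    have "inverse ?g * ?g = 1" by (rule inverse_mult_eq_1[OF g0])
    hence "inverse ?g = 1 + fps_X ^ n * inverse ?g" by (simp add: algebra_simps)
    hence "fps_nth (inverse ?g) k = fps_nth (1 + fps_X ^ n * inverse ?g) k" by (rule arg_cong)
    also have "\<dots> = (if k = 0 then 1 else 0)" using that by (simp add: fps_X_power_mult_nth)
    finally show ?thesis using True by simp
  qed auto
  have step: "fps_nth (P (Suc n)) k = fps_nth (P n) k" if "k \<le> n" for n k
  proof -
    have "fps_nth (P (Suc n)) k = fps_nth (P n * ?f (Suc n)) k" by (simp add: P_def)
    also have "\<dots> = (\<Sum>i=0..k. fps_nth (P n) i * fps_nth (?f (Suc n)) (k - i))"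
      by (rule fps_mult_nth)
    also have "\<dots> = (\<Sum>i=0..k. fps_nth (P n) i * (if i = k then 1 else 0))"
      by (intro sum.cong refl, subst nth) (use that in auto)
    also have "\<dots> = (\<Sum>i=0..k. if i = k then fps_nth (P n) i else 0)"
      by (intro sum.cong) auto
    also have "\<dots> = fps_nth (P n) k" by simp
    finally show ?thesis .
  qed
  have stable: "fps_nth (P n) k = fps_nth (P k) k" if "k \<le> n" for n k
    using that by (induction n rule: dec_induct) (simp_all add: step)
  define L where "L = Abs_fps (\<lambda>k. fps_nth (P k) k)"
  have "P \<longlonglongrightarrow> L"
  proof (rule tendsto_fpsI)
    show "\<forall>\<^sub>F n in sequentially. fps_nth (P n) k = fps_nth L k" for k
      using eventually_ge_at_top[of k] by eventually_elim (unfold L_def fps_nth_Abs_fps, rule stable)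
  qed
  moreover have "fps_nth L 0 = 1" by (simp add: L_def P_def)
  hence "L \<noteq> 0" by auto
  ultimately have "raw_has_prod ?f 0 L" unfolding raw_has_prod_def P_def add_0_right by blast
  thus ?thesis by (auto simp: convergent_prod_def)
qed

end

theory Submission
  imports Defs
begin

text \<open>
  Removing \<open>s\<close> copies of a part \<open>a\<close> shows that \<open>W\<^sub>s\<close> has generating function
  \<open>\<Phi> \<cdot> \<Sum>\<^sub>a q\<^bsup>as\<^esup>\<close>, the sum being over indivisible \<open>a\<close>. By coprimality the double sum defining
  \<open>c\<^bsub>r\<^sub>i,n\<^esub>\<close> runs once over each \<open>s \<ge> 1\<close>, weighted by the exponent of \<open>r\<^sub>i\<close> in \<open>s\<close>. Hence the
  coefficient of \<open>q\<^sup>N\<close> in the cofactor of \<open>\<Phi>\<close> is the number of pairs \<open>(a, k)\<close> with \<open>a\<close> indivisible,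
  \<open>k \<ge> 1\<close> and \<open>r\<^sub>i\<^sup>k a\<close> dividing \<open>N\<close>; these pairs correspond to the \<open>d = r\<^sub>i\<^bsup>k-1\<^esup> a\<close> counted by the
  last Lambert series. The alternating sum is inclusion-exclusion over the moduli dividing \<open>d\<close>.
\<close>

subsection \<open>Geometric and Lambert series\<close>

text \<open>Multiplying by \<open>1 - fps_X ^ a\<close> subtracts the indicator of the multiples of
  \<open>a\<close> shifted by \<open>a\<close>; only the constant term survives.\<close>

lemma inverse_one_minus_fps_X_power:
  assumes "a \<ge> 1"
  shows "inverse (1 - fps_X ^ a :: 'a :: field fps) = Abs_fps (\<lambda>N. if a dvd N then 1 else 0)"
proof (rule fps_inverse_unique)
  show "(1 - fps_X ^ a) * Abs_fps (\<lambda>N. if a dvd N then 1 else 0) = (1 :: 'a fps)"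
  proof (rule fps_ext)
    fix N
    show "fps_nth ((1 - fps_X ^ a) * Abs_fps (\<lambda>N. if a dvd N then 1 else 0)) N
        = fps_nth (1 :: 'a fps) N"
      using assms by (auto simp: left_diff_distrib fps_X_power_mult_nth dvd_minus_self dest: dvd_imp_le)
  qed
qed

text \<open>The term is the geometric series minus 1, which is why the multiple 0 of
  \<open>a\<close> is left out.\<close>

lemma fps_nth_lambert_term:
  assumes "a \<ge> 1"
  shows "fps_nth (fps_X ^ a / (1 - fps_X ^ a) :: 'a :: field fps) N
           = (if N \<ge> 1 \<and> a dvd N then 1 else 0)"
proof -
  let ?g = "1 - fps_X ^ a :: 'a fps"
  have g0: "fps_nth ?g 0 \<noteq> 0" using assms by simp
  have "inverse ?g * ?g = 1" by (rule inverse_mult_eq_1[OF g0])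
  moreover have "fps_X ^ a / ?g = fps_X ^ a * inverse ?g" by (rule fps_divide_unit[OF g0])
  ultimately have "fps_X ^ a / ?g = inverse ?g - 1" by (simp add: algebra_simps)
  thus ?thesis using assms by (auto simp: inverse_one_minus_fps_X_power)
qed

lemma fps_nth_lambert:
  assumes "a \<ge> 1" "0 \<notin> A"
  shows "fps_nth (lambert a A) N = (if N \<ge> 1 then of_nat (card {n\<in>A. a * n dvd N}) else 0)"
proof -
  let ?F = "\<lambda>n. fps_X ^ (a * n) / (1 - fps_X ^ (a * n)) :: rat fps"
  have nth: "fps_nth (?F n) N = (if N \<ge> 1 \<and> a * n dvd N then 1 else 0)" if "n \<in> A" for n
    by (rule fps_nth_lambert_term) (use assms that in \<open>auto simp: Suc_le_eq intro: gr0I\<close>)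
  have "(?F has_sum lambert a A) A"
    unfolding lambert_def using lambert_summable[OF assms] by (rule has_sum_infsum)
  \<comment> \<open>In the X-adic topology each coefficient of the infinite sum is a finite sum over
    the terms that contribute to it.\<close>
  hence "fps_nth (lambert a A) N = (\<Sum>n | n \<in> A \<and> fps_nth (?F n) N \<noteq> 0. fps_nth (?F n) N)"
    by (rule has_sum_fpsD)
  also have "\<dots> = (\<Sum>n | n \<in> A \<and> N \<ge> 1 \<and> a * n dvd N. 1)"
    by (rule sum.cong) (auto simp: nth split: if_splits)
  finally show ?thesis by simp
qed

subsection \<open>The product counts partitions\<close>

lemma CP_add_mset:
  assumes "a \<ge> 1" "indivisible m r a"
  shows "add_mset a \<rho> \<in> CP m r n \<longleftrightarrow> a \<le> n \<and> \<rho> \<in> CP m r (n - a)"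
  using assms by (auto simp: CP_def)

lemma CP_part_le: "\<rho> \<in> CP m r n \<Longrightarrow> a \<in># \<rho> \<Longrightarrow> a \<le> n"
  unfolding CP_def by (metis (mono_tags, lifting) le_add1 mem_Collect_eq multi_member_split sum_mset.add_mset)

text \<open>The partitions counted by the partial product up to \<open>N\<close>; bounding the parts
  allows induction on \<open>N\<close>.\<close>

definition CP_le :: "nat \<Rightarrow> (nat \<Rightarrow> nat) \<Rightarrow> nat \<Rightarrow> nat \<Rightarrow> nat multiset set" where
  "CP_le m r N n = {\<rho> \<in> CP m r n. \<forall>a\<in>#\<rho>. a \<le> N}"

lemma finite_CP_le: "finite (CP_le m r N n)"
  by (simp add: CP_le_def finite_CP)

lemma CP_le_0: "CP_le m r 0 n = (if n = 0 then {{#}} else {})"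
proof -
  have "CP_le m r 0 n \<subseteq> {{#}}"
  proof
    fix \<rho> assume "\<rho> \<in> CP_le m r 0 n"
    thus "\<rho> \<in> {{#}}" by (cases \<rho>) (auto simp: CP_le_def CP_def)
  qed
  moreover have "{#} \<in> CP_le m r 0 n \<longleftrightarrow> n = 0" by (auto simp: CP_le_def CP_def)
  ultimately show ?thesis by auto
qed

lemma CP_le_Suc_divisible:
  "\<not> indivisible m r (Suc N) \<Longrightarrow> CP_le m r (Suc N) n = CP_le m r N n"
  by (auto simp: CP_le_def CP_def le_Suc_eq)

text \<open>Split by whether \<open>Suc N\<close> is a part. If it is, one copy is removed and
  further copies may remain, so the second term keeps the bound \<open>Suc N\<close>.\<close>

lemma card_CP_le_Suc:
  assumes "indivisible m r (Suc N)"
  shows "card (CP_le m r (Suc N) n) =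
    card (CP_le m r N n) + (if Suc N \<le> n then card (CP_le m r (Suc N) (n - Suc N)) else 0)"
proof -
  let ?B = "if Suc N \<le> n then add_mset (Suc N) ` CP_le m r (Suc N) (n - Suc N) else {}"
  have "CP_le m r (Suc N) n = CP_le m r N n \<union> ?B"
  proof (intro set_eqI iffI)
    fix \<rho> assume \<rho>: "\<rho> \<in> CP_le m r (Suc N) n"
    show "\<rho> \<in> CP_le m r N n \<union> ?B"
    proof (cases "Suc N \<in># \<rho>")
      case True
      then obtain \<sigma> where "\<rho> = add_mset (Suc N) \<sigma>" by (metis multi_member_split)
      thus ?thesis using \<rho> assms by (auto simp: CP_le_def CP_add_mset)
    next
      case False
      thus ?thesis using \<rho> by (auto simp: CP_le_def le_Suc_eq)
    qed
  next
    fix \<rho> assume "\<rho> \<in> CP_le m r N n \<union> ?B"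
    thus "\<rho> \<in> CP_le m r (Suc N) n"
      using assms by (auto simp: CP_le_def CP_add_mset split: if_splits)
  qed
  moreover have "CP_le m r N n \<inter> ?B = {}" by (auto simp: CP_le_def)
  ultimately have "card (CP_le m r (Suc N) n) = card (CP_le m r N n) + card ?B"
    by (simp add: card_Un_disjoint finite_CP_le)
  also have "card ?B = (if Suc N \<le> n then card (CP_le m r (Suc N) (n - Suc N)) else 0)"
    by (simp add: card_image inj_on_def)
  finally show ?thesis .
qed

lemma partial_Phi:
  "(\<Prod>n\<le>N. if n \<ge> 1 \<and> indivisible m r n then inverse (1 - fps_X ^ n) else 1)
     = (Abs_fps (\<lambda>n. of_nat (card (CP_le m r N n))) :: rat fps)"
proof (induction N)
  case 0
  show ?case by (rule fps_ext) (simp add: CP_le_0)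
next
  case (Suc N)
  let ?A = "\<lambda>N. Abs_fps (\<lambda>n. of_nat (card (CP_le m r N n))) :: rat fps"
  show ?case
  proof (cases "indivisible m r (Suc N)")
    case False
    thus ?thesis using Suc by (simp add: CP_le_Suc_divisible)
  next
    case True
    let ?g = "1 - fps_X ^ Suc N :: rat fps"
    \<comment> \<open>Coefficientwise this is the recurrence \<open>card_CP_le_Suc\<close>;
      multiplying by \<open>?g\<close> avoids expanding its inverse.\<close>
    have "?A (Suc N) * ?g = ?A N"
    proof (rule fps_ext)
      fix n
      show "fps_nth (?A (Suc N) * ?g) n = fps_nth (?A N) n"
        using card_CP_le_Suc[OF True, of n]
        by (simp add: right_diff_distrib fps_X_power_mult_right_nth del: power_Suc)
    qed
    moreover have "?g * inverse ?g = 1"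
      by (rule inverse_mult_eq_1') simp
    ultimately have "?A (Suc N) = ?A N * inverse ?g"
      by (simp only: mult.assoc mult_1_right flip: \<open>?A (Suc N) * ?g = ?A N\<close>)
    thus ?thesis using Suc True by simp
  qed
qed

text \<open>No part of a partition of \<open>n\<close> exceeds \<open>n\<close>, so the coefficient
  of \<open>q^n\<close> in the partial products is constant from \<open>N = n\<close> on.\<close>

lemma Phi_eq: "Phi m r = Abs_fps (\<lambda>n. of_nat (card (CP m r n)))"
proof -
  let ?f = "\<lambda>n. if n \<ge> 1 \<and> indivisible m r n then inverse (1 - fps_X ^ n) else 1 :: rat fps"
  let ?L = "Abs_fps (\<lambda>n. of_nat (card (CP m r n))) :: rat fps"
  have "(\<lambda>N. \<Prod>n\<le>N. ?f n) \<longlonglongrightarrow> ?L"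
    unfolding partial_Phi
  proof (rule tendsto_fpsI)
    fix n
    have "CP_le m r N n = CP m r n" if "N \<ge> n" for N
      using that by (auto simp: CP_le_def dest: CP_part_le)
    thus "\<forall>\<^sub>F N in sequentially.
        fps_nth (Abs_fps (\<lambda>n. of_nat (card (CP_le m r N n)))) n = fps_nth ?L n"
      by (intro eventually_mono[OF eventually_ge_at_top[of n]]) simp
  qed
  \<comment> \<open>A convergent product must have a nonzero limit; the empty partition makes the
    constant coefficient 1.\<close>
  moreover have "CP m r 0 = {{#}}"
    using CP_le_0[of m r 0] by (auto simp: CP_le_def dest: CP_part_le)
  hence "fps_nth ?L 0 = 1" by simp
  hence "?L \<noteq> 0" by force
  ultimately have "?f has_prod ?L"
    unfolding has_prod_def raw_has_prod_def add_0_right by blast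
  thus ?thesis unfolding Phi_def by (rule has_prod_unique[symmetric])
qed

subsection \<open>Partitions with a part of multiplicity at least \<open>s\<close>\<close>

lemma CP_add_replicate_mset:
  assumes "a \<ge> 1" "indivisible m r a"
  shows "replicate_mset s a + \<rho> \<in> CP m r n \<longleftrightarrow> a * s \<le> n \<and> \<rho> \<in> CP m r (n - a * s)"
  using assms by (auto simp: CP_def mult.commute split: if_splits)

lemma card_CP_count_ge:
  assumes "a \<ge> 1" "indivisible m r a"
  shows "card {\<rho> \<in> CP m r n. count \<rho> a \<ge> s} = (if a * s \<le> n then card (CP m r (n - a * s)) else 0)"
proof -
  have "{\<rho> \<in> CP m r n. count \<rho> a \<ge> s} =
      (if a * s \<le> n then (\<lambda>\<rho>. replicate_mset s a + \<rho>) ` CP m r (n - a * s) else {})" (is "?A = ?B")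
  proof (intro set_eqI iffI)
    fix \<rho> assume \<rho>: "\<rho> \<in> ?A"
    hence "replicate_mset s a \<subseteq># \<rho>" by (simp add: count_le_replicate_mset_subset_eq)
    then obtain \<sigma> where "\<rho> = replicate_mset s a + \<sigma>" by (metis subset_mset.le_iff_add)
    thus "\<rho> \<in> ?B" using \<rho> CP_add_replicate_mset[OF assms] by auto
  qed (use CP_add_replicate_mset[OF assms] in \<open>auto split: if_splits\<close>)
  thus ?thesis by (simp add: card_image)
qed

text \<open>Double counting of pairs of a partition and a part in it: exchange the two sums, then
  apply \<open>card_CP_count_ge\<close> to each part.\<close>

lemma W_eq:
  assumes "s \<ge> 1"
  shows "W m r s n = (\<Sum>a | a \<in> {1..n} \<and> indivisible m r a \<and> a * s \<le> n. card (CP m r (n - a * s)))"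
proof -
  let ?A = "{a \<in> {1..n}. indivisible m r a}"
  \<comment> \<open>Since \<open>s\<close> is positive, every counted \<open>a\<close> is a part,
    hence indivisible and at most \<open>n\<close>.\<close>
  have "{a. a \<ge> 1 \<and> count \<rho> a \<ge> s} = {a \<in> ?A. count \<rho> a \<ge> s}" if "\<rho> \<in> CP m r n" for \<rho>
  proof -
    have "a \<in> ?A" if "a \<ge> 1" "count \<rho> a \<ge> s" for a
    proof -
      have "a \<in># \<rho>" using that assms by (intro count_inI) auto
      thus ?thesis using CP_part_le[OF \<open>\<rho> \<in> CP m r n\<close>] \<open>\<rho> \<in> CP m r n\<close> that by (auto simp: CP_def)
    qed
    thus ?thesis by auto
  qed
  hence "W m r s n = (\<Sum>\<rho>\<in>CP m r n. card {a \<in> ?A. count \<rho> a \<ge> s})"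
    by (simp add: W_def)
  also have "\<dots> = (\<Sum>\<rho>\<in>CP m r n. \<Sum>a\<in>?A. if count \<rho> a \<ge> s then 1 else 0)"
    by (simp add: sum.inter_filter[symmetric])
  also have "\<dots> = (\<Sum>a\<in>?A. \<Sum>\<rho>\<in>CP m r n. if count \<rho> a \<ge> s then 1 else 0)"
    by (rule sum.swap)
  also have "\<dots> = (\<Sum>a\<in>?A. card {\<rho> \<in> CP m r n. count \<rho> a \<ge> s})"
    by (simp add: sum.inter_filter[symmetric] finite_CP)
  also have "\<dots> = (\<Sum>a\<in>?A. if a * s \<le> n then card (CP m r (n - a * s)) else 0)"
    by (rule sum.cong) (auto simp: card_CP_count_ge)
  also have "\<dots> = (\<Sum>a | a \<in> {1..n} \<and> indivisible m r a \<and> a * s \<le> n. card (CP m r (n - a * s)))"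
    by (subst sum.inter_filter[symmetric]) (auto intro: sum.cong)
  finally show ?thesis .
qed

subsection \<open>Factoring out the moduli\<close>

text \<open>Applied to powers of the moduli when they are factored out of \<open>s\<close>, and to
  the moduli themselves in the inclusion-exclusion.\<close>

lemma prod_dvd_iff_pairwise_coprime:
  fixes n :: nat
  assumes "finite A" "\<And>x y. x \<in> A \<Longrightarrow> y \<in> A \<Longrightarrow> x \<noteq> y \<Longrightarrow> coprime (f x) (f y)"
  shows "(\<Prod>x\<in>A. f x) dvd n \<longleftrightarrow> (\<forall>x\<in>A. f x dvd n)"
  using assms
proof (induction A rule: finite_induct)
  case (insert x A)
  have "coprime (f x) (\<Prod>x\<in>A. f x)"
    using insert by (intro prod_coprime_right) (metis insert_iff)
  hence "f x * (\<Prod>x\<in>A. f x) dvd n \<longleftrightarrow> f x dvd n \<and> (\<Prod>x\<in>A. f x) dvd n"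
    by (meson divides_mult dvd_mult_left dvd_mult_right)
  thus ?case using insert by simp
qed simp

locale coprime_moduli =
  fixes m :: nat and r :: "nat \<Rightarrow> nat"
  assumes ge2: "l \<in> {1..m} \<Longrightarrow> r l \<ge> 2"
    and coprime: "l \<in> {1..m} \<Longrightarrow> l' \<in> {1..m} \<Longrightarrow> l \<noteq> l' \<Longrightarrow> coprime (r l) (r l')"
begin

lemma not_unit: "l \<in> {1..m} \<Longrightarrow> \<not> is_unit (r l)"
  using ge2[of l] by auto

lemma prod_powers_pos: "(\<Prod>l=1..m. r l ^ k l) > 0"
  using ge2 by (intro prod_pos) (force intro: zero_less_power)

lemma multiplicity_prod_powers:
  assumes j: "indivisible m r j" and l: "l \<in> {1..m}"
  shows "multiplicity (r l) ((\<Prod>l=1..m. r l ^ k l) * j) = k l"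
proof -
  define Q where "Q = (\<Prod>l'\<in>{1..m} - {l}. r l' ^ k l')"
  have Q: "(\<Prod>l=1..m. r l ^ k l) = r l ^ k l * Q"
    unfolding Q_def using l by (intro prod.remove) auto
  \<comment> \<open>As \<open>r l\<close> may be composite, it could divide \<open>Q * j\<close>
    without dividing either factor; coprimality to \<open>Q\<close> excludes this.\<close>
  have "coprime (r l) Q"
    unfolding Q_def using l coprime[of l] by (intro prod_coprime_right) auto
  moreover have "\<not> r l dvd j" using j l by (auto simp: indivisible_def)
  ultimately have "\<not> r l dvd Q * j" by (simp add: coprime_dvd_mult_right_iff)
  moreover have "r l \<noteq> 0" using ge2[OF l] by auto
  ultimately have "\<not> r l ^ Suc (k l) dvd r l ^ k l * (Q * j)" by simp
  thus ?thesis unfolding Q mult.assoc by (intro multiplicity_eqI) auto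
qed

text \<open>Existence of the factorisation: the powers are pairwise coprime, so their product
  divides \<open>s\<close>, and a further factor \<open>r l\<close> in the cofactor would contradict
  maximality of the exponent.\<close>

lemma indivisible_cofactor:
  assumes "s \<ge> 1"
  defines "P \<equiv> \<Prod>l=1..m. r l ^ multiplicity (r l) s"
  shows "P dvd s" "indivisible m r (s div P)"
proof -
  show dvd: "P dvd s"
    unfolding P_def using coprime
    by (subst prod_dvd_iff_pairwise_coprime) (auto simp: multiplicity_dvd)
  show "indivisible m r (s div P)"
    unfolding indivisible_def
  proof (intro ballI notI)
    fix l assume l: "l \<in> {1..m}" and d: "r l dvd s div P"
    have "r l ^ multiplicity (r l) s dvd P"
      unfolding P_def using l by (intro dvd_prodI) auto
    hence "r l ^ multiplicity (r l) s * r l dvd P * (s div P)" using d by (rule mult_dvd_mono)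
    hence "r l ^ Suc (multiplicity (r l) s) dvd s" using dvd by (simp add: mult.commute)
    thus False
      using power_dvd_iff_le_multiplicity[of s "r l" "Suc (multiplicity (r l) s)"] assms(1) not_unit[OF l]
      by simp
  qed
qed

text \<open>Every \<open>s \<ge> 1\<close> is uniquely of the form \<open>r\<^sub>1\<^bsup>k\<^sub>1\<^esup> \<cdots> r\<^sub>m\<^bsup>k\<^sub>m\<^esup> j\<close> with \<open>j\<close> indivisible, even though
  the \<open>r\<^sub>l\<close> need not be prime.\<close>

lemma cnum_eq:
  assumes i: "i \<in> {1..m}"
  shows "cnum m r i n = (\<Sum>s=1..n. multiplicity (r i) s * W m r s n)"
proof -
  let ?P = "\<lambda>k. \<Prod>l=1..m. r l ^ k l"
  let ?J = "{j. j \<ge> 1 \<and> indivisible m r j}"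
  let ?J' = "{j \<in> {1..n}. indivisible m r j}"
  let ?K = "{1..m} \<rightarrow>\<^sub>E (UNIV :: nat set)"
  let ?K' = "{1..m} \<rightarrow>\<^sub>E {..n}"
  let ?t = "\<lambda>j k. k i * W m r (?P k * j) n"
  have Ppos: "?P k \<ge> 1" for k using prod_powers_pos[of k] by linarith
  have zero: "W m r (?P k * j) n = 0" if "j > n" for j k
    by (rule W_eq_0) (use that Ppos[of k] in \<open>metis less_le_trans mult_le_mono1 nat_mult_1\<close>)
  \<comment> \<open>Outside the finite box some exponent exceeds \<open>n\<close>, so the product of
    powers does too and \<open>W\<close> vanishes.\<close>
  have inner: "(\<Sum>\<^sub>\<infinity>k\<in>?K. ?t j k) = (\<Sum>k\<in>?K'. ?t j k)" if j: "j \<ge> 1" for j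
  proof -
    have "(\<Sum>\<^sub>\<infinity>k\<in>?K. ?t j k) = (\<Sum>\<^sub>\<infinity>k\<in>?K'. ?t j k)"
    proof (rule infsum_cong_neutral)
      fix k assume k: "k \<in> ?K - ?K'"
      then obtain l where l: "l \<in> {1..m}" "k l > n" by (force simp: PiE_iff)
      have "k l < ?P k" by (rule power_prod_ge) (use ge2 l in auto)
      also have "\<dots> \<le> ?P k * j" using j by simp
      finally have "W m r (?P k * j) n = 0" using l by (intro W_eq_0) simp
      thus "?t j k = 0" by simp
    qed auto
    thus ?thesis by (simp add: finite_PiE)
  qed
  have "cnum m r i n = (\<Sum>\<^sub>\<infinity>j\<in>?J. \<Sum>k\<in>?K'. ?t j k)"
    unfolding cnum_def by (rule infsum_cong) (rule inner, simp)
  also have "\<dots> = (\<Sum>\<^sub>\<infinity>j\<in>?J'. \<Sum>k\<in>?K'. ?t j k)"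
    by (rule infsum_cong_neutral) (auto simp: zero[simplified])
  also have "\<dots> = (\<Sum>j\<in>?J'. \<Sum>k\<in>?K'. ?t j k)" by simp
  also have "\<dots> = (\<Sum>(j, k)\<in>?J' \<times> ?K'. ?t j k)"
    by (rule sum.cartesian_product)
  also have "\<dots> = (\<Sum>s=1..n. multiplicity (r i) s * W m r s n)"
  \<comment> \<open>The box also contains pairs with product above \<open>n\<close>; their terms
    vanish, and they form the exceptional set \<open>S'\<close>. The exponent tuple is restricted to
    \<open>{1..m}\<close> because members of \<open>?K'\<close> are extensional.\<close>
  proof (rule sum.reindex_bij_witness_not_neutral[where
        S' = "{(j, k) \<in> ?J' \<times> ?K'. ?P k * j > n}" and T' = "{}" and
        j = "\<lambda>(j, k). ?P k * j" and
        i = "\<lambda>s. (s div ?P (\<lambda>l. multiplicity (r l) s), \<lambda>l\<in>{1..m}. multiplicity (r l) s)"])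
    show "finite {(j, k) \<in> ?J' \<times> ?K'. ?P k * j > n}"
      by (rule finite_subset[of _ "?J' \<times> ?K'"]) (auto intro!: finite_PiE)
  next
    fix a assume a: "a \<in> ?J' \<times> ?K' - {(j, k) \<in> ?J' \<times> ?K'. ?P k * j > n}"
    then obtain j k where [simp]: "a = (j, k)" and j: "j \<ge> 1" "indivisible m r j"
      and k: "k \<in> ?K'" and le: "?P k * j \<le> n" by (cases a) auto
    have mult: "multiplicity (r l) (?P k * j) = k l" if "l \<in> {1..m}" for l
      using multiplicity_prod_powers[OF j(2) that] .
    have "?P (\<lambda>l. multiplicity (r l) (?P k * j)) = ?P k"
      by (rule prod.cong) (simp_all only: mult)
    moreover have "(\<lambda>l\<in>{1..m}. multiplicity (r l) (?P k * j)) = k"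
      using k by (intro ext) (auto simp: mult[simplified] PiE_def extensional_def restrict_def)
    moreover have "?P k * j div ?P k = j"
      using Ppos[of k] by (intro nonzero_mult_div_cancel_left) linarith
    ultimately show "(\<lambda>s. (s div ?P (\<lambda>l. multiplicity (r l) s), \<lambda>l\<in>{1..m}. multiplicity (r l) s))
        (case a of (j, k) \<Rightarrow> ?P k * j) = a"
      by (simp only: \<open>a = (j, k)\<close> prod.case)
    show "(case a of (j, k) \<Rightarrow> ?P k * j) \<in> {1..n} - {}"
      using le mult_le_mono[OF Ppos[of k] j(1)] by simp
  next
    fix a assume "a \<in> ?J' \<times> ?K'"
    thus "multiplicity (r i) (case a of (j, k) \<Rightarrow> ?P k * j) *
        W m r (case a of (j, k) \<Rightarrow> ?P k * j) n = (case a of (j, k) \<Rightarrow> ?t j k)"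
      using multiplicity_prod_powers[OF _ i] by auto
  next
    fix s assume s: "s \<in> {1..n} - {}"
    let ?k = "\<lambda>l\<in>{1..m}. multiplicity (r l) s"
    let ?Q = "?P (\<lambda>l. multiplicity (r l) s)"
    have Pk: "?P ?k = ?Q" by (rule prod.cong) auto
    have Q: "?Q dvd s" "indivisible m r (s div ?Q)" using indivisible_cofactor[of s] s by auto
    show eq: "(case (s div ?Q, ?k) of (j, k) \<Rightarrow> ?P k * j) = s"
      using Q(1) by (simp add: Pk)
    have "multiplicity (r l) s \<le> n" if l: "l \<in> {1..m}" for l
    proof -
      have "multiplicity (r l) s < ?Q"
        by (rule power_prod_ge[where k = "\<lambda>l. multiplicity (r l) s"]) (use ge2 l in auto)
      moreover have "?Q \<le> s" using Q(1) s by (intro dvd_imp_le) auto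
      ultimately show ?thesis using s by simp
    qed
    hence "?k \<in> ?K'" by auto
    moreover have "s div ?Q \<in> ?J'"
    proof -
      have "s div ?Q \<noteq> 0" using Q(1) s by (auto simp: dvd_div_eq_0_iff)
      moreover have "s div ?Q \<le> n" using s by (meson DiffD1 atLeastAtMost_iff div_le_dividend order_trans)
      ultimately show ?thesis using Q(2) by simp
    qed
    ultimately show "(s div ?Q, ?k) \<in> ?J' \<times> ?K' - {(j, k) \<in> ?J' \<times> ?K'. ?P k * j > n}"
      using eq s by auto
  qed (auto simp: W_eq_0)
  finally show ?thesis .
qed

section \<open>Cofactor-exponent pairs and the convolution formula\<close>

definition admissible :: "nat \<Rightarrow> nat set" where
  "admissible i = {n. n \<ge> 1 \<and> (\<forall>l\<in>{1..m} - {i}. \<not> r l dvd n)}"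

text \<open>The bijection \<open>(a, k) \<mapsto> r\<^sub>i\<^bsup>k-1\<^esup> a\<close> works because, by coprimality, powers of \<open>r\<^sub>i\<close> do not affect
  divisibility by the other moduli.\<close>

lemma sum_multiplicity_cofactors:
  assumes i: "i \<in> {1..m}" and N: "N \<ge> 1"
  shows "(\<Sum>a | a dvd N \<and> indivisible m r a. multiplicity (r i) (N div a))
           = card {d \<in> admissible i. r i * d dvd N}"
proof -
  let ?A = "{a. a dvd N \<and> indivisible m r a}"
  let ?S = "SIGMA a:?A. {1..multiplicity (r i) (N div a)}"
  let ?D = "{d \<in> admissible i. r i * d dvd N}"
  have fin: "finite ?A" using N by simp
  have ri: "r i > 0" using ge2[OF i] by simp
  have cop: "r l dvd r i ^ e * a \<longleftrightarrow> r l dvd a" if "l \<in> {1..m} - {i}" for l e a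
    using that coprime[of l i] i by (intro coprime_dvd_mult_right_iff) auto
  have "(\<Sum>a\<in>?A. multiplicity (r i) (N div a)) = card ?S"
    using fin by simp
  also have "\<dots> = card ?D"
  \<comment> \<open>Here \<open>k\<close> starts at 1 but the exponent of \<open>r i\<close> in
    \<open>d\<close> starts at 0. The factor lost by the shift reappears in
    \<open>r i * d dvd N\<close>.\<close>
  proof (rule bij_betw_same_card[OF bij_betw_byWitness[where
        f = "\<lambda>(a, k). r i ^ (k - 1) * a" and
        f' = "\<lambda>d. (d div r i ^ multiplicity (r i) d, Suc (multiplicity (r i) d))"]])
    have mult: "multiplicity (r i) (r i ^ e * a) = e" if "indivisible m r a" for a e
      using that i ri by (intro multiplicity_eqI) (auto simp: indivisible_def)
    show "\<forall>p\<in>?S. (\<lambda>d. (d div r i ^ multiplicity (r i) d, Suc (multiplicity (r i) d)))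
        (case p of (a, k) \<Rightarrow> r i ^ (k - 1) * a) = p"
      using ri by (auto simp: mult simp del: One_nat_def)
    show "\<forall>d\<in>?D. (case (d div r i ^ multiplicity (r i) d, Suc (multiplicity (r i) d)) of
        (a, k) \<Rightarrow> r i ^ (k - 1) * a) = d"
      by (simp add: multiplicity_dvd)
    show "(\<lambda>(a, k). r i ^ (k - 1) * a) ` ?S \<subseteq> ?D"
    proof clarify
      fix a k assume a: "a dvd N" "indivisible m r a" and k: "k \<in> {1..multiplicity (r i) (N div a)}"
      have a0: "a \<noteq> 0" using a(1) N by auto
      have "r i ^ k dvd N div a" using k by (intro multiplicity_dvd') simp
      hence "r i ^ k * a dvd N" using a a0 by (simp add: dvd_div_iff_mult)
      moreover have "r i * (r i ^ (k - 1) * a) = r i ^ k * a" using k by (cases k) auto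
      moreover have "r i ^ (k - 1) * a \<in> admissible i"
        using a a0 ri cop by (auto simp: admissible_def indivisible_def Suc_le_eq)
      ultimately show "r i ^ (k - 1) * a \<in> admissible i \<and> r i * (r i ^ (k - 1) * a) dvd N"
        by (simp only: simp_thms)
    qed
    show "(\<lambda>d. (d div r i ^ multiplicity (r i) d, Suc (multiplicity (r i) d))) ` ?D \<subseteq> ?S"
    proof
      fix p assume "p \<in> (\<lambda>d. (d div r i ^ multiplicity (r i) d, Suc (multiplicity (r i) d))) ` ?D"
      then obtain d where d: "d \<in> admissible i" "r i * d dvd N"
        and p: "p = (d div r i ^ multiplicity (r i) d, Suc (multiplicity (r i) d))" by blast
      have d0: "d \<noteq> 0" using d by (auto simp: admissible_def)
      define e where "e = multiplicity (r i) d"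
      obtain a where a: "d = r i ^ e * a" "\<not> r i dvd a"
        unfolding e_def using multiplicity_decompose'[OF d0 not_unit[OF i]] by blast
      have "indivisible m r a"
        unfolding indivisible_def
      proof
        fix l assume "l \<in> {1..m}"
        \<comment> \<open>For \<open>l = i\<close> this is the choice of \<open>a\<close>; for other
          \<open>l\<close> it passes from \<open>d\<close> to \<open>a\<close> by
          \<open>cop\<close>.\<close>
        thus "\<not> r l dvd a" using a d cop[of l e a] by (cases "l = i") (auto simp: admissible_def)
      qed
      moreover have *: "r i ^ Suc e * a dvd N" using d(2) a(1) by (simp add: mult.assoc)
      moreover have aN: "a dvd N" using * by (rule dvd_mult_right)
      moreover have "a \<noteq> 0" using a d0 by auto
      ultimately have "r i ^ Suc e dvd N div a" by (simp add: dvd_div_iff_mult)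
      moreover have "N div a \<noteq> 0" using aN N by (auto simp: dvd_div_eq_0_iff)
      ultimately have "Suc e \<le> multiplicity (r i) (N div a)"
        using not_unit[OF i] by (intro multiplicity_geI)
      moreover have "d div r i ^ e = a" using a ri by simp
      ultimately show "p \<in> ?S" using p aN \<open>indivisible m r a\<close> by (simp add: e_def)
    qed
  qed
  finally show ?thesis .
qed

text \<open>Insert \<open>W_eq\<close> and collect the pairs \<open>(s, a)\<close> by their product
  \<open>N = a * s\<close>. The partition count depends on \<open>N\<close> alone, and the remaining
  weights are summed by \<open>sum_multiplicity_cofactors\<close>.\<close>

lemma cnum_eq_convolution:
  assumes i: "i \<in> {1..m}"
  shows "cnum m r i n = (\<Sum>N=1..n. card (CP m r (n - N)) * card {d \<in> admissible i. r i * d dvd N})"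
proof -
  let ?v = "multiplicity (r i)"
  have "cnum m r i n = (\<Sum>s=1..n. \<Sum>a | a \<in> {1..n} \<and> indivisible m r a \<and> a * s \<le> n.
      ?v s * card (CP m r (n - a * s)))"
    unfolding cnum_eq[OF i] by (intro sum.cong refl) (simp add: W_eq sum_distrib_left)
  also have "\<dots> = (\<Sum>(s, a)\<in>(SIGMA s:{1..n}. {a. a \<in> {1..n} \<and> indivisible m r a \<and> a * s \<le> n}).
      ?v s * card (CP m r (n - a * s)))"
    by (rule sum.Sigma) auto
  also have "\<dots> = (\<Sum>(N, a)\<in>(SIGMA N:{1..n}. {a. a dvd N \<and> indivisible m r a}).
      card (CP m r (n - N)) * ?v (N div a))"
  proof (rule sum.reindex_bij_witness[where
        j = "\<lambda>(s, a). (a * s, a)" and i = "\<lambda>(N, a). (N div a, a)"])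
    fix b assume "b \<in> (SIGMA N:{1..n}. {a. a dvd N \<and> indivisible m r a})"
    then obtain N a where [simp]: "b = (N, a)" and N: "1 \<le> N" "N \<le> n"
      and a: "a dvd N" "indivisible m r a" by auto
    then obtain s where s: "N = a * s" by (auto elim: dvdE)
    show "(case b of (N, a) \<Rightarrow> (N div a, a)) \<in>
        (SIGMA s:{1..n}. {a. a \<in> {1..n} \<and> indivisible m r a \<and> a * s \<le> n})"
      using N a s by (auto simp: Suc_le_eq intro: order_trans[rotated] gr0I)
  qed (auto simp: Suc_le_eq intro: gr0I)
  also have "\<dots> = (\<Sum>N=1..n. \<Sum>a | a dvd N \<and> indivisible m r a. card (CP m r (n - N)) * ?v (N div a))"
    by (rule sum.Sigma[symmetric]) auto
  also have "\<dots> = (\<Sum>N=1..n. card (CP m r (n - N)) * card {d \<in> admissible i. r i * d dvd N})"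
    by (intro sum.cong refl) (simp add: sum_distrib_left[symmetric] sum_multiplicity_cofactors[OF i])
  finally show ?thesis .
qed

lemma cnum_generating_function:
  assumes i: "i \<in> {1..m}"
  shows "Abs_fps (\<lambda>n. of_nat (cnum m r i n)) = Phi m r * lambert (r i) (admissible i)"
proof (rule fps_ext)
  fix n
  have "r i \<ge> 1" "0 \<notin> admissible i" using ge2[OF i] by (auto simp: admissible_def)
  note nth = fps_nth_lambert[OF this]
  have "fps_nth (Phi m r * lambert (r i) (admissible i)) n =
      fps_nth (lambert (r i) (admissible i) * Phi m r) n" by (simp add: mult.commute)
  also have "\<dots> = (\<Sum>N=0..n. fps_nth (lambert (r i) (admissible i)) N * of_nat (card (CP m r (n - N))))"
    by (simp add: fps_mult_nth Phi_eq)
  \<comment> \<open>The Lambert series has no constant term, so the Cauchy product starts at 1 like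
    the convolution.\<close>
  also have "\<dots> = (\<Sum>N=1..n. fps_nth (lambert (r i) (admissible i)) N * of_nat (card (CP m r (n - N))))"
    by (rule sum.mono_neutral_right) (auto simp: nth)
  also have "\<dots> = of_nat (cnum m r i n)"
    unfolding cnum_eq_convolution[OF i] by (simp add: nth mult.commute)
  finally show "fps_nth (Abs_fps (\<lambda>n. of_nat (cnum m r i n))) n =
      fps_nth (Phi m r * lambert (r i) (admissible i)) n" by simp
qed

subsection \<open>Inclusion and exclusion\<close>

text \<open>In the coefficient of \<open>q^N\<close>, the series for \<open>L\<close> counts the
  \<open>d\<close> with \<open>r i * d dvd N\<close> divisible by every \<open>r l\<close> in
  \<open>L\<close>. For fixed \<open>d\<close> the signed sum over \<open>L\<close> is the expansion
  of the product of \<open>1 - [r l dvd d]\<close>.\<close>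

lemma lambert_admissible:
  assumes i: "i \<in> {1..m}"
  shows "lambert (r i) (admissible i) =
    (\<Sum>L\<in>Pow ({1..m} - {i}). (-1) ^ card L * lambert (r i * (\<Prod>l\<in>L. r l)) {1..})"
proof (rule fps_ext)
  fix N
  let ?I = "{1..m} - {i}"
  let ?R = "\<lambda>L. r i * (\<Prod>l\<in>L. r l)"
  have ri: "r i \<ge> 1" using ge2[OF i] by simp
  have pos: "(\<Prod>l\<in>L. r l) > 0" if "L \<in> Pow ?I" for L
    using that ge2 by (intro prod_pos) force
  have R: "?R L \<ge> 1" if "L \<in> Pow ?I" for L
    using ri pos[OF that] by (simp add: Suc_le_eq)
  have sign: "fps_nth ((-1) ^ k * F) N = (-1) ^ k * fps_nth F N" for k and F :: "rat fps"
    by (simp add: minus_one_power_iff)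
  show "fps_nth (lambert (r i) (admissible i)) N =
      fps_nth (\<Sum>L\<in>Pow ?I. (-1) ^ card L * lambert (?R L) {1..}) N"
  proof (cases "N \<ge> 1")
    case False
    have "fps_nth (lambert (?R L) {1..}) N = 0" if "L \<in> Pow ?I" for L
      using False by (subst fps_nth_lambert[OF R[OF that]]) auto
    moreover have "fps_nth (lambert (r i) (admissible i)) N = 0"
      using False by (subst fps_nth_lambert[OF ri]) (auto simp: admissible_def)
    ultimately show ?thesis by (simp add: fps_sum_nth sign del: One_nat_def)
  next
    case N: True
    let ?D = "{d. d \<ge> 1 \<and> r i * d dvd N}"
    have finD: "finite ?D"
      by (rule finite_subset[of _ "{d. d dvd N}"]) (use N dvd_mult_right in auto)
    have count: "of_nat (card {n \<in> {1..}. ?R L * n dvd N}) =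
        (\<Sum>d\<in>?D. \<Prod>l\<in>L. if r l dvd d then 1 else 0 :: rat)" if L: "L \<in> Pow ?I" for L
    proof -
      have finL: "finite L" using L finite_subset by auto
      have dvd: "(\<Prod>l\<in>L. r l) dvd d \<longleftrightarrow> (\<forall>l\<in>L. r l dvd d)" for d
        using L by (intro prod_dvd_iff_pairwise_coprime finL coprime) auto
      \<comment> \<open>Absorb the moduli of \<open>L\<close> into the summation variable:
        \<open>d\<close> is their product times \<open>n\<close>.\<close>
      have "bij_betw (\<lambda>n. (\<Prod>l\<in>L. r l) * n) {n \<in> {1..}. ?R L * n dvd N}
          {d \<in> ?D. (\<Prod>l\<in>L. r l) dvd d}"
        by (rule bij_betw_byWitness[where f' = "\<lambda>d. d div (\<Prod>l\<in>L. r l)"])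
           (use pos[OF L] in \<open>auto simp: Suc_le_eq mult.assoc elim!: dvdE[of "prod r L"] intro!: gr0I\<close>)
      hence "card {n \<in> {1..}. ?R L * n dvd N} = card {d \<in> ?D. \<forall>l\<in>L. r l dvd d}"
        unfolding dvd by (rule bij_betw_same_card)
      also have "of_nat \<dots> = (\<Sum>d\<in>?D. if \<forall>l\<in>L. r l dvd d then 1 else 0 :: rat)"
        using finD by (simp add: sum.inter_filter[symmetric])
      also have "\<dots> = (\<Sum>d\<in>?D. \<Prod>l\<in>L. if r l dvd d then 1 else 0)"
        using finL by (intro sum.cong refl) (auto simp: prod_zero_iff)
      finally show ?thesis .
    qed
    have "fps_nth (\<Sum>L\<in>Pow ?I. (-1) ^ card L * lambert (?R L) {1..}) N =
        (\<Sum>L\<in>Pow ?I. (-1) ^ card L * of_nat (card {n \<in> {1..}. ?R L * n dvd N}))"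
      unfolding fps_sum_nth
      by (intro sum.cong refl) (use N in \<open>auto simp: fps_nth_lambert[OF R] sign\<close>)
    also have "\<dots> = (\<Sum>L\<in>Pow ?I. \<Sum>d\<in>?D. (-1) ^ card L * (\<Prod>l\<in>L. if r l dvd d then 1 else 0))"
      by (intro sum.cong refl) (simp only: count sum_distrib_left)
    also have "\<dots> = (\<Sum>d\<in>?D. \<Sum>L\<in>Pow ?I. (-1) ^ card L * (\<Prod>l\<in>L. if r l dvd d then 1 else 0))"
      by (rule sum.swap)
    also have "\<dots> = (\<Sum>d\<in>?D. \<Prod>l\<in>?I. - (if r l dvd d then 1 else 0) + 1)"
      by (simp only: prod_add finite_Diff finite_atLeastAtMost prod_uminus prod.neutral_const mult_1_right)
    \<comment> \<open>A single modulus dividing \<open>d\<close> makes its factor, and so the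
      product, zero; otherwise all factors are 1.\<close>
    also have "\<dots> = (\<Sum>d\<in>?D. if \<forall>l\<in>?I. \<not> r l dvd d then 1 else 0)"
      by (intro sum.cong refl) (auto simp: prod_zero_iff intro!: prod.neutral)
    also have "\<dots> = of_nat (card {d \<in> ?D. \<forall>l\<in>?I. \<not> r l dvd d})"
      using finD by (simp add: sum.inter_filter[symmetric])
    also have "{d \<in> ?D. \<forall>l\<in>?I. \<not> r l dvd d} = {d \<in> admissible i. r i * d dvd N}"
      by (auto simp: admissible_def)
    also have "of_nat (card \<dots>) = fps_nth (lambert (r i) (admissible i)) N"
      using N ri by (subst fps_nth_lambert) (auto simp: admissible_def)
    finally show ?thesis by simp
  qed
qed

end

text \<open>Grouping by cardinality gives the layered form of the alternating sum, with the empty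
  set split off. Finiteness of \<open>I\<close> ensures that only the empty subset has
  \<open>card\<close> 0.\<close>

lemma sum_Pow_eq_sum_card:
  fixes f :: "'a set \<Rightarrow> 'b :: comm_ring_1"
  assumes "finite I"
  shows "(\<Sum>L\<in>Pow I. (-1) ^ card L * f L) =
    f {} + (\<Sum>k=1..card I. (-1) ^ k * (\<Sum>L\<in>{L. L \<subseteq> I \<and> card L = k}. f L))"
proof -
  have "(\<Sum>L\<in>Pow I. (-1) ^ card L * f L) =
      (\<Sum>k\<in>{0..card I}. \<Sum>L\<in>{L \<in> Pow I. card L = k}. (-1) ^ card L * f L)"
    using assms by (intro sum.group[symmetric]) (auto intro: card_mono)
  also have "\<dots> = (\<Sum>k\<in>{0..card I}. (-1) ^ k * (\<Sum>L\<in>{L. L \<subseteq> I \<and> card L = k}. f L))"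
    by (intro sum.cong refl) (simp add: sum_distrib_left)
  also have "\<dots> = (\<Sum>L\<in>{L. L \<subseteq> I \<and> card L = 0}. f L)
      + (\<Sum>k=1..card I. (-1) ^ k * (\<Sum>L\<in>{L. L \<subseteq> I \<and> card L = k}. f L))"
    by (simp add: sum.atLeast_Suc_atMost)
  also have "{L. L \<subseteq> I \<and> card L = 0} = {{}}"
    using assms by (auto dest: finite_subset)
  finally show ?thesis by simp
qed

theorem theorem2p4:
  fixes m :: nat and r :: "nat \<Rightarrow> nat" and i :: nat
  assumes "m \<ge> 1"
    and "\<And>l. l \<in> {1..m} \<Longrightarrow> r l \<ge> 2"
    and "\<And>l l'. l \<in> {1..m} \<Longrightarrow> l' \<in> {1..m} \<Longrightarrow> l \<noteq> l' \<Longrightarrow> coprime (r l) (r l')"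
    and "i \<in> {1..m}"
  shows "Phi m r = Abs_fps (\<lambda>n. of_nat (card (CP m r n))) \<and>
         Abs_fps (\<lambda>n. of_nat (cnum m r i n)) =
           Phi m r * (lambert (r i) {1..} +
             (\<Sum>k=1..m-1. (-1) ^ k *
               (\<Sum>L\<in>{L. L \<subseteq> {1..m} - {i} \<and> card L = k}.
                 lambert (r i * (\<Prod>l\<in>L. r l)) {1..}))) \<and>
         Phi m r * (lambert (r i) {1..} +
             (\<Sum>k=1..m-1. (-1) ^ k *
               (\<Sum>L\<in>{L. L \<subseteq> {1..m} - {i} \<and> card L = k}.
                 lambert (r i * (\<Prod>l\<in>L. r l)) {1..}))) =
           Phi m r * lambert (r i) {n. n \<ge> 1 \<and> (\<forall>l\<in>{1..m} - {i}. \<not> r l dvd n)}"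
proof -
  interpret coprime_moduli m r by unfold_locales (fact assms)+
  \<comment> \<open>This supplies the upper limit \<open>m - 1\<close> of the alternating
    sum.\<close>
  have "card ({1..m} - {i}) = m - 1" using assms(4) by simp
  hence "lambert (r i) (admissible i) = lambert (r i) {1..} +
      (\<Sum>k=1..m-1. (-1) ^ k *
        (\<Sum>L\<in>{L. L \<subseteq> {1..m} - {i} \<and> card L = k}. lambert (r i * (\<Prod>l\<in>L. r l)) {1..}))"
    unfolding lambert_admissible[OF assms(4)] by (subst sum_Pow_eq_sum_card) simp_all
  thus ?thesis
    using Phi_eq[of m r] cnum_generating_function[OF assms(4)] by (simp only: admissible_def)
qed

end
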